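(* Let favors be substitutable with per-period payoffs $u_i(g)=\alpha v\big(1-(1-p)^{d_i(g)}\big)-\sum_{j\in N_i(g)}\alpha c\,\frac{1-(1-p)^{d_j(g)}}{d_j(g)}$, where $\alpha\in(0,1]$, $p\in(0,1)$, $v>c>0$. Let $g$ be a network on a finite player set and $i,j,k$ distinct players. (1) If $d_j(g)=d_k(g)$, $ij\notin g$ and $ik\notin g$, then $u_i(g+ik)=u_i(g+ij)$ and $$u_i(g+ij)-u_i(g)>u_i(g+ij+ik)-u_i(g+ij).$$ (2) If $ij\in g$ and $jk\notin g$, then $u_i(g+jk)>u_i(g)$.
   Context: A network $g$ is an undirected simple graph on a finite set of players, viewed as its set of links; $g+ij$ denotes $g$ with the link $ij$ added; $N_i(g)=\{j: ij\in g\}$ and $d_i(g)=|N_i(g)|$. The function $u_i(g)$ is player $i$'s expected per-period payoff in network $g$ when every favor is provided: each player needs a favor (worth $v$ to the recipient, costing $c$ to the provider) with probability $\alpha$, each neighbor is able to provide it independently with probability $p$, and the provider is uniformly selected among able neighbors. *)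

theory Defs
  imports Complex_Main
begin

type_synonym 'a net = "'a set set"

definition network :: "'a set \<Rightarrow> 'a net \<Rightarrow> bool" where
  "network P g \<longleftrightarrow> finite P \<and> (\<forall>e\<in>g. e \<subseteq> P \<and> card e = 2)"

definition add_link :: "'a net \<Rightarrow> 'a \<Rightarrow> 'a \<Rightarrow> 'a net" where
  "add_link g i j = insert {i, j} g"

definition neighbors :: "'a net \<Rightarrow> 'a \<Rightarrow> 'a set" where
  "neighbors g i = {j. {i, j} \<in> g}"

definition link_degree :: "'a net \<Rightarrow> 'a \<Rightarrow> nat" where
  "link_degree g i = card (neighbors g i)"

text \<open>
  Expected per-period payoff when every favor is provided and favors are substitutable.
  A player in need, which happens with probability \<open>\<alpha>\<close>, has an able neighbor with
  probability \<open>1 - (1 - p) ^ d\<close>, where \<open>d\<close> is the player's degree; each neighbor is the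
  selected provider with equal probability, whence the division by the degree of \<open>j\<close> in the cost
  term. In a network every neighbor \<open>j\<close> of \<open>i\<close> has positive degree, so
  that division is never by zero.
\<close>

definition payoff :: "real \<Rightarrow> real \<Rightarrow> real \<Rightarrow> real \<Rightarrow> 'a net \<Rightarrow> 'a \<Rightarrow> real" where
  "payoff \<alpha> p v c g i =
     \<alpha> * v * (1 - (1 - p) ^ link_degree g i)
     - (\<Sum>j\<in>neighbors g i. \<alpha> * c * ((1 - (1 - p) ^ link_degree g j) / real (link_degree g j)))"

end

theory Submission
  imports Defs
begin

text \<open>
  Write \<open>q = 1 - p\<close> and \<open>f d = (1 - q ^ d) / d\<close> for the probability that a favor
  needed by a player of degree \<open>d\<close> is provided by a given neighbor. A new link of \<open>i\<close> to \<open>j\<close> leaves the degrees of the other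
  neighbors of \<open>i\<close> alone, so it changes the payoff of \<open>i\<close> by
  \<open>\<alpha> v p q ^ d\<^sub>i - \<alpha> c f (d\<^sub>j + 1)\<close>; for fixed \<open>d\<^sub>j\<close> this is strictly decreasing in \<open>d\<^sub>i\<close>, which gives
  part 1. A link among others affects \<open>i\<close> only through \<open>f\<close>, and \<open>f\<close> is strictly decreasing on
  positive degrees, which gives part 2.
\<close>

text \<open>Bernoulli replaces the linear factor by \<open>(1 + p) ^ n\<close>, and
  \<open>(1 - p) * (1 + p) = 1 - p\<^sup>2\<close> lies below 1.\<close>

lemma power_times_linear_less_one:
  fixes p :: real
  assumes "0 < p" "p < 1" "0 < n"
  shows "(1 - p) ^ n * (1 + real n * p) < 1"
proof -
  have "(1 - p) ^ n * (1 + real n * p) \<le> (1 - p) ^ n * (1 + p) ^ n"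
    using assms Bernoulli_inequality[of p n] by (intro mult_left_mono) auto
  also have "\<dots> = (1 - p\<^sup>2) ^ n"
    by (simp add: power_mult_distrib[symmetric] algebra_simps power2_eq_square)
  also have "\<dots> < 1"
    using assms by (intro power_less_one_iff[THEN iffD2]) (auto simp: power_le_one)
  finally show ?thesis .
qed

text \<open>Clearing denominators and collecting the powers of \<open>1 - p\<close> turns the claim
  into \<open>(1 - p) ^ n * (1 + real n * p) < 1\<close>.\<close>

lemma burden_strict_decreasing:
  fixes p :: real
  assumes "0 < p" "p < 1" "0 < n"
  shows "(1 - (1 - p) ^ Suc n) / real (Suc n) < (1 - (1 - p) ^ n) / real n"
proof -
  have "real n * (1 - (1 - p) ^ Suc n) < real (Suc n) * (1 - (1 - p) ^ n)"
    using power_times_linear_less_one[OF assms] by (simp add: algebra_simps)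
  then show ?thesis
    using \<open>0 < n\<close> by (simp add: field_simps)
qed

lemma finite_neighbors:
  assumes "network P g"
  shows "finite (neighbors g x)"
proof (rule finite_subset)
  show "neighbors g x \<subseteq> P"
    using assms by (fastforce simp: network_def neighbors_def)
  show "finite P"
    using assms by (simp add: network_def)
qed

lemma not_self_neighbor:
  assumes "network P g"
  shows "x \<notin> neighbors g x"
  using assms by (force simp: network_def neighbors_def)

lemma network_add_link:
  assumes "network P g" "a \<in> P" "b \<in> P" "a \<noteq> b"
  shows "network P (add_link g a b)"
  using assms by (auto simp: network_def add_link_def)

lemma neighbors_add_link:
  assumes "a \<noteq> b"
  shows "neighbors (add_link g a b) x =
    (if x = a then insert b (neighbors g x)
     else if x = b then insert a (neighbors g x) else neighbors g x)"
  using assms by (auto simp: neighbors_def add_link_def doubleton_eq_iff)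

lemma link_degree_add_link:
  assumes "network P g" "a \<noteq> b" "{a, b} \<notin> g"
  shows "link_degree (add_link g a b) x =
    (if x = a \<or> x = b then Suc (link_degree g x) else link_degree g x)"
proof -
  have "b \<notin> neighbors g a" "a \<notin> neighbors g b"
    using assms by (auto simp: neighbors_def insert_commute)
  then show ?thesis
    using assms by (auto simp: link_degree_def neighbors_add_link finite_neighbors)
qed

lemma payoff_add_own_link:
  assumes "network P g" "i \<noteq> j" "{i, j} \<notin> g"
  shows "payoff \<alpha> p v c (add_link g i j) i - payoff \<alpha> p v c g i =
    \<alpha> * v * p * (1 - p) ^ link_degree g i
    - \<alpha> * c * ((1 - (1 - p) ^ Suc (link_degree g j)) / real (Suc (link_degree g j)))"
proof -
  let ?cost = "\<lambda>h x. \<alpha> * c * ((1 - (1 - p) ^ link_degree h x) / real (link_degree h x))"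
  let ?h = "add_link g i j"
  have j: "j \<notin> neighbors g i"
    using assms by (simp add: neighbors_def)
  \<comment> \<open>Neither \<open>i\<close> nor \<open>j\<close> is among the old neighbors of
    \<open>i\<close>, so none of their degrees changes.\<close>
  have "sum (?cost ?h) (neighbors g i) = sum (?cost g) (neighbors g i)"
    using j not_self_neighbor[OF assms(1), of i]
    by (intro sum.cong refl) (auto simp: link_degree_add_link[OF assms])
  then have "sum (?cost ?h) (neighbors ?h i) = ?cost ?h j + sum (?cost g) (neighbors g i)"
    using j \<open>i \<noteq> j\<close> by (simp add: neighbors_add_link finite_neighbors[OF assms(1)])
  then show ?thesis
    by (simp add: payoff_def link_degree_add_link[OF assms] algebra_simps del: of_nat_Suc)
qed

text \<open>The term of \<open>j\<close> falls strictly. Whether \<open>k\<close> is also a neighbor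
  of \<open>i\<close> is left open: its term then falls too, and otherwise it is absent from the
  sum.\<close>

lemma payoff_add_link_of_neighbor:
  assumes "network P g" "j \<noteq> k" "{i, j} \<in> g" "{j, k} \<notin> g" "i \<noteq> j" "i \<noteq> k"
    and "0 < \<alpha>" "0 < c" "0 < p" "p < 1"
  shows "payoff \<alpha> p v c g i < payoff \<alpha> p v c (add_link g j k) i"
proof -
  let ?cost = "\<lambda>h x. \<alpha> * c * ((1 - (1 - p) ^ link_degree h x) / real (link_degree h x))"
  let ?h = "add_link g j k"
  note degree = link_degree_add_link[OF assms(1,2,4)]
  \<comment> \<open>Degree 0 must be excluded: there the quotient is 0 by the convention for
    division by zero, and it would rise with a new link.\<close>
  have pos: "0 < link_degree g x" if "x \<in> neighbors g i" for x
  proof -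
    have "i \<in> neighbors g x"
      using that by (simp add: neighbors_def insert_commute)
    then show ?thesis
      using finite_neighbors[OF assms(1)] by (auto simp: link_degree_def card_gt_0_iff)
  qed
  have less: "?cost ?h x < ?cost g x" if "x \<in> neighbors g i" "x = j \<or> x = k" for x
  proof -
    have "link_degree ?h x = Suc (link_degree g x)"
      using that(2) by (simp add: degree)
    then show ?thesis
      using burden_strict_decreasing[OF assms(9,10) pos[OF that(1)]] assms(7,8)
      by (simp only: mult_strict_left_mono mult_pos_pos)
  qed
  have j: "j \<in> neighbors g i"
    using assms by (simp add: neighbors_def)
  have "sum (?cost ?h) (neighbors g i) < sum (?cost g) (neighbors g i)"
  proof (rule sum_strict_mono_ex1)
    show "\<forall>x\<in>neighbors g i. ?cost ?h x \<le> ?cost g x"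
    proof
      fix x assume "x \<in> neighbors g i"
      then show "?cost ?h x \<le> ?cost g x"
        using less[of x] by (cases "x = j \<or> x = k") (auto simp: degree)
    qed
    show "\<exists>x\<in>neighbors g i. ?cost ?h x < ?cost g x"
      using j less by blast
  qed (rule finite_neighbors[OF assms(1)])
  then show ?thesis
    using assms(2,5,6) by (simp add: payoff_def neighbors_add_link degree)
qed

theorem proposition1:
  fixes \<alpha> p v c :: real
    and P :: "'a set"
    and g :: "'a net"
    and i j k :: 'a
  defines "u \<equiv> payoff \<alpha> p v c"
  assumes "0 < \<alpha>" and "\<alpha> \<le> 1"
    and "0 < p" and "p < 1"
    and "0 < c" and "c < v"
    and "network P g"
    and "i \<in> P" and "j \<in> P" and "k \<in> P"
    and "i \<noteq> j" and "i \<noteq> k" and "j \<noteq> k"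
  shows "(link_degree g j = link_degree g k \<and> {i, j} \<notin> g \<and> {i, k} \<notin> g \<longrightarrow>
            u (add_link g i k) i = u (add_link g i j) i \<and>
            u (add_link g i j) i - u g i
              > u (add_link (add_link g i j) i k) i - u (add_link g i j) i)
         \<and> ({i, j} \<in> g \<and> {j, k} \<notin> g \<longrightarrow> u (add_link g j k) i > u g i)"
proof (intro conjI impI)
  assume new: "link_degree g j = link_degree g k \<and> {i, j} \<notin> g \<and> {i, k} \<notin> g"
  note gain_j = payoff_add_own_link[OF \<open>network P g\<close> \<open>i \<noteq> j\<close>, of \<alpha> p v c]
  note gain_k = payoff_add_own_link[OF \<open>network P g\<close> \<open>i \<noteq> k\<close>, of \<alpha> p v c]
  show "u (add_link g i k) i = u (add_link g i j) i"
    using gain_j gain_k new by (simp add: u_def)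
  have net: "network P (add_link g i j)"
    using assms by (intro network_add_link)
  have "{i, k} \<notin> add_link g i j"
    using new \<open>j \<noteq> k\<close> by (auto simp: add_link_def doubleton_eq_iff)
  note gain_k' = payoff_add_own_link[OF net \<open>i \<noteq> k\<close> this, of \<alpha> p v c]
  \<comment> \<open>The link to \<open>j\<close> raises the degree of \<open>i\<close> but not that
    of \<open>k\<close>, so both gains carry the same cost and differ only in the benefit, which
    shrinks by the factor \<open>1 - p\<close>.\<close>
  have degree: "link_degree (add_link g i j) i = Suc (link_degree g i)"
    "link_degree (add_link g i j) k = link_degree g j"
    using link_degree_add_link[OF \<open>network P g\<close> \<open>i \<noteq> j\<close>] new assms by auto
  have "\<alpha> * v * p * (1 - p) ^ Suc (link_degree g i) < \<alpha> * v * p * (1 - p) ^ link_degree g i"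
    using assms by (intro mult_strict_left_mono power_strict_decreasing) auto
  then show "u (add_link g i j) i - u g i
      > u (add_link (add_link g i j) i k) i - u (add_link g i j) i"
    using gain_j gain_k' new unfolding degree u_def by linarith
next
  assume "{i, j} \<in> g \<and> {j, k} \<notin> g"
  then show "u (add_link g j k) i > u g i"
    unfolding u_def using assms by (intro payoff_add_link_of_neighbor) auto
qed

end
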